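(* Let $D$ be a strongly connected balanced bipartite digraph of order $2a\geq 8$ with partite sets $X$ and $Y$. Suppose that $\max\{d(x),d(y)\}\geq 2a-1$ for every dominating pair of vertices $\{x,y\}$ of $D$. Then $D$ contains a cycle of length $2a-2$ or $D$ is a directed cycle.
   Context: All digraphs are finite, without loops and without multiple arcs (but both arcs $xy$ and $yx$ may be present). A digraph $D$ is bipartite if its vertex set has a partition into two partite sets $X,Y$ such that every arc has its end-vertices in different partite sets; it is balanced if $|X|=|Y|$. The order of $D$ is its number of vertices. $D$ is strongly connected if for every pair of distinct vertices $x,y$ there are a directed path from $x$ to $y$ and a directed path from $y$ to $x$. Write $x\rightarrow z$ if $xz$ is an arc of $D$. A pair $\{x,y\}$ of distinct vertices is a dominating pair if there is a vertex $z$ with $x\rightarrow z$ and $y\rightarrow z$. The degree of $x$ is $d(x)=d^+(x)+d^-(x)$, the sum of the out-degree and the in-degree of $x$ in $D$. A cycle means a directed cycle $x_1x_2\cdots x_mx_1$ with distinct vertices $x_1,\dots,x_m$, $m\geq 2$; its length is its number $m$ of arcs. "$D$ is a directed cycle" means that $D$ consists exactly of the vertices and arcs of a single directed cycle (of length $2a$). *)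

theory Defs
  imports "Graph_Theory.Digraph_Component"
begin

text \<open>
  Digraphs without loops and multiple arcs are those of the locale \<^locale>\<open>digraph\<close>,
  which includes finiteness. Walks and cycles are lists of arcs there, so the length of
  the list is the number of arcs.
\<close>

definition bipartition :: "('a, 'b) pre_digraph \<Rightarrow> 'a set \<Rightarrow> 'a set \<Rightarrow> bool" where
  "bipartition D X Y \<longleftrightarrow>
     X \<union> Y = verts D \<and> X \<inter> Y = {} \<and>
     (\<forall>e \<in> arcs D. tail D e \<in> X \<and> head D e \<in> Y \<or> tail D e \<in> Y \<and> head D e \<in> X)"

definition balanced_bipartition :: "('a, 'b) pre_digraph \<Rightarrow> 'a set \<Rightarrow> 'a set \<Rightarrow> bool" where
  "balanced_bipartition D X Y \<longleftrightarrow> bipartition D X Y \<and> card X = card Y"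

definition vertex_degree :: "('a, 'b) pre_digraph \<Rightarrow> 'a \<Rightarrow> nat" where
  "vertex_degree D x = out_degree D x + in_degree D x"

definition dominating_pair :: "('a, 'b) pre_digraph \<Rightarrow> 'a \<Rightarrow> 'a \<Rightarrow> bool" where
  "dominating_pair D x y \<longleftrightarrow>
     x \<in> verts D \<and> y \<in> verts D \<and> x \<noteq> y \<and>
     (\<exists>z \<in> verts D. x \<rightarrow>\<^bsub>D\<^esub> z \<and> y \<rightarrow>\<^bsub>D\<^esub> z)"

text \<open>
  On a cycle every vertex is the tail of exactly one arc, so the tails of the arcs of
  \<open>p\<close> are precisely the vertices of \<open>p\<close>. In a loop-free digraph a cycle has length at
  least 2.
\<close>

definition is_directed_cycle :: "('a, 'b) pre_digraph \<Rightarrow> bool" where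
  "is_directed_cycle D \<longleftrightarrow>
     (\<exists>p. pre_digraph.cycle D p \<and> verts D = tail D ` set p \<and> arcs D = set p)"

end

theory Submission
  imports Defs
begin

text \<open>
  Call a vertex big if its degree is at least \<open>2a - 1\<close>; it then misses at most one of its
  \<open>2a\<close> possible arcs, and among the in-neighbours of any vertex at most one is not big.
  If no vertex has two in-neighbours, the digraph is a directed cycle. Otherwise some vertex is
  big, and since almost everything dominates it, each partite set has at most two vertices that
  are not big.

  If each partite set has at most one such vertex, delete one vertex from each side so that only
  big ones remain: the missing arcs join only partners of some perfect matching, and a cycle
  through all remaining vertices that avoids the matching exists. If one partite set has two
  vertices that are not big, every big vertex on the other side misses an arc from one of these
  two and hence nothing else, so the big vertices induce a complete bipartite digraph, into which
  one further vertex on each side can be inserted.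
\<close>

section \<open>Alternating cycles in a relation\<close>

text \<open>\<open>n\<close> counts the vertices of one side, so the cycle has length
  \<open>2 * n\<close>. A relation with two indexed families keeps arc lists out of the
  constructions; \<open>n = 0\<close> holds vacuously.\<close>

definition alternating_cycle :: "'a rel \<Rightarrow> nat \<Rightarrow> bool" where
  "alternating_cycle r n \<longleftrightarrow>
     (\<exists>x y. inj_on x {..<n} \<and> inj_on y {..<n} \<and> x ` {..<n} \<inter> y ` {..<n} = {} \<and>
        (\<forall>i<n. (x i, y i) \<in> r \<and> (y i, x (Suc i mod n)) \<in> r))"

lemma alternating_cycleI:
  assumes "bij_betw x {..<n} A" "bij_betw y {..<n} B" "A \<inter> B = {}"
    and "\<And>i. i < n \<Longrightarrow> (x i, y i) \<in> r"
    and "\<And>i. i < n \<Longrightarrow> (y i, x (Suc i mod n)) \<in> r"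
  shows "alternating_cycle r n"
  unfolding alternating_cycle_def
  using assms by (intro exI[of _ x] exI[of _ y]) (simp add: bij_betw_def)

lemma exists_bij_betw_two_values:
  assumes "finite A" "card A = n" "i < n" "j < n" "i \<noteq> j" "s \<in> A" "t \<in> A" "s \<noteq> t"
  obtains f where "bij_betw f {..<n::nat} A" "f i = s" "f j = t"
proof -
  have "card ({..<n} - {i, j}) = card (A - {s, t})"
    using assms by (subst (1 2) card_Diff_subset) auto
  then obtain h where h: "bij_betw h ({..<n} - {i, j}) (A - {s, t})"
    using assms(1) finite_same_card_bij by blast
  let ?f = "h(i := s, j := t)"
  have "bij_betw ?f ({..<n} - {i, j}) (A - {s, t})"
    using h by (rule bij_betw_cong[THEN iffD1, rotated]) auto
  moreover have "bij_betw ?f {i, j} {s, t}"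
    using assms by (auto simp: bij_betw_def)
  ultimately have "bij_betw ?f ({..<n} - {i, j} \<union> {i, j}) (A - {s, t} \<union> {s, t})"
    by (rule bij_betw_combine) auto
  moreover have "{..<n} - {i, j} \<union> {i, j} = {..<n}" "A - {s, t} \<union> {s, t} = A"
    using assms by auto
  ultimately have "bij_betw ?f {..<n} A" by simp
  then show thesis
    using assms(5) that[of ?f] by simp
qed

text \<open>\<open>P\<close> is a partial injection; its domain and range leave complements of equal
  size, and any bijection between these completes it. With \<open>P\<close> saying that an arc is
  missing, all missing arcs lie within one perfect matching.\<close>

lemma partial_matching_extends_to_bij:
  assumes "finite A" "finite B" "card A = card B"
    and fun_like: "\<And>x y y'. \<lbrakk>x \<in> A; y \<in> B; y' \<in> B; P x y; P x y'\<rbrakk> \<Longrightarrow> y = y'"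
    and inj_like: "\<And>x x' y. \<lbrakk>x \<in> A; x' \<in> A; y \<in> B; P x y; P x' y\<rbrakk> \<Longrightarrow> x = x'"
  obtains m where "bij_betw m A B" "\<And>x y. \<lbrakk>x \<in> A; y \<in> B; P x y\<rbrakk> \<Longrightarrow> y = m x"
proof -
  define A' where "A' = {x \<in> A. \<exists>y \<in> B. P x y}"
  define f where "f x = (SOME y. y \<in> B \<and> P x y)" for x
  have f: "f x \<in> B" "P x (f x)" if "x \<in> A'" for x
    using someI_ex[of "\<lambda>y. y \<in> B \<and> P x y"] that unfolding f_def A'_def by auto
  have sub: "A' \<subseteq> A" "f ` A' \<subseteq> B"
    using f by (auto simp: A'_def)
  have "inj_on f A'"
  proof (rule inj_onI)
    fix x x' assume "x \<in> A'" "x' \<in> A'" "f x = f x'"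
    then show "x = x'"
      using inj_like[of x x' "f x"] f[of x] f[of x'] sub(1) by auto
  qed
  then have bij1: "bij_betw f A' (f ` A')"
    by (rule inj_on_imp_bij_betw)
  have "card (A - A') = card (B - f ` A')"
    using sub assms(1-3) bij_betw_same_card[OF bij1]
    by (simp add: card_Diff_subset finite_subset)
  then obtain g where g: "bij_betw g (A - A') (B - f ` A')"
    using assms(1,2) finite_same_card_bij by blast
  let ?m = "\<lambda>x. if x \<in> A' then f x else g x"
  have "bij_betw ?m (A' \<union> (A - A')) (f ` A' \<union> (B - f ` A'))"
  proof (rule bij_betw_combine)
    show "bij_betw ?m A' (f ` A')"
      using bij1 by (rule bij_betw_cong[THEN iffD1, rotated]) auto
    show "bij_betw ?m (A - A') (B - f ` A')"
      using g by (rule bij_betw_cong[THEN iffD1, rotated]) auto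
  qed auto
  then have "bij_betw ?m A B"
    using sub by (simp add: Un_absorb1)
  moreover have "y = ?m x" if "x \<in> A" "y \<in> B" "P x y" for x y
  proof -
    have "x \<in> A'" using that by (auto simp: A'_def)
    then show ?thesis using that f fun_like by auto
  qed
  ultimately show thesis by (rule that)
qed

text \<open>Missing arcs join only partners of a perfect matching \<open>m\<close>, so any
  alternating order in which no two partners are consecutive is a cycle.\<close>

lemma alternating_cycle_minus_matching:
  assumes fin: "finite A" "finite B" and disj: "A \<inter> B = {}"
    and card: "card A = n" "card B = n" and n: "n \<ge> 3"
    and fun_like: "\<And>x y y'. \<lbrakk>x \<in> A; y \<in> B; y' \<in> B; y \<noteq> y'\<rbrakk> \<Longrightarrow>
      (x, y) \<in> r \<and> (y, x) \<in> r \<or> (x, y') \<in> r \<and> (y', x) \<in> r"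
    and inj_like: "\<And>x x' y. \<lbrakk>x \<in> A; x' \<in> A; y \<in> B; x \<noteq> x'\<rbrakk> \<Longrightarrow>
      (x, y) \<in> r \<and> (y, x) \<in> r \<or> (x', y) \<in> r \<and> (y, x') \<in> r"
  shows "alternating_cycle r n"
proof -
  obtain m where m: "bij_betw m A B"
    and nonadj: "\<And>x y. \<lbrakk>x \<in> A; y \<in> B; \<not> ((x, y) \<in> r \<and> (y, x) \<in> r)\<rbrakk> \<Longrightarrow> y = m x"
  proof (rule partial_matching_extends_to_bij[of A B "\<lambda>x y. \<not> ((x, y) \<in> r \<and> (y, x) \<in> r)"])
    show "y = y'" if "x \<in> A" "y \<in> B" "y' \<in> B" "\<not> ((x, y) \<in> r \<and> (y, x) \<in> r)"
        "\<not> ((x, y') \<in> r \<and> (y', x) \<in> r)" for x y y'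
      using that fun_like by blast
    show "x = x'" if "x \<in> A" "x' \<in> A" "y \<in> B" "\<not> ((x, y) \<in> r \<and> (y, x) \<in> r)"
        "\<not> ((x', y) \<in> r \<and> (y, x') \<in> r)" for x x' y
      using that inj_like by blast
  qed (use fin card in auto)
  obtain x where x: "bij_betw x {..<n} A"
    using fin card by (metis card_lessThan finite_lessThan finite_same_card_bij)
  define s where "s i = (i + 2) mod n" for i
  have s_lt: "s i < n" for i using n by (simp add: s_def)
  have "inj_on s {..<n}"
  proof (rule inj_onI)
    fix i j assume "i \<in> {..<n}" "j \<in> {..<n}" "s i = s j"
    then show "i = j"
      using n by (auto simp: s_def mod_if split: if_splits)
  qed
  then have s: "bij_betw s {..<n} {..<n}"
    using s_lt by (simp add: bij_betw_def endo_inj_surj image_subset_iff)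
  \<comment> \<open>\<open>y i\<close> is the partner of \<open>x (i + 2)\<close>, hence joined to both \<open>x i\<close> and \<open>x (i + 1)\<close>.\<close>
  have y: "bij_betw (m \<circ> x \<circ> s) {..<n} B"
    by (rule bij_betw_trans[OF s bij_betw_trans[OF x m]])
  have arcs: "(x i, m (x (s j))) \<in> r \<and> (m (x (s j)), x i) \<in> r"
    if "i < n" "j < n" "i \<noteq> s j" for i j
  proof (rule ccontr)
    assume neg: "\<not> ?thesis"
    have "x i \<in> A" "x (s j) \<in> A"
      using x that s_lt by (auto simp: bij_betw_def)
    with neg nonadj[of "x i" "m (x (s j))"] have "m (x (s j)) = m (x i)"
      using m by (auto simp: bij_betw_def)
    with \<open>x i \<in> A\<close> \<open>x (s j) \<in> A\<close> have "x (s j) = x i"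
      using m by (auto simp: bij_betw_def dest: inj_onD)
    with x that s_lt show False
      by (auto simp: bij_betw_def dest!: inj_onD)
  qed
  show ?thesis
  proof (rule alternating_cycleI[OF x y disj])
    fix i assume "i < n"
    \<comment> \<open>As \<open>n\<close> \<ge> 3, the residues of \<open>i\<close>,
      \<open>i + 1\<close> and \<open>i + 2\<close> are pairwise distinct.\<close>
    moreover have "i \<noteq> s i" "Suc i mod n \<noteq> s i"
      using n \<open>i < n\<close> by (auto simp: s_def mod_if split: if_splits)
    ultimately show "(x i, (m \<circ> x \<circ> s) i) \<in> r" "((m \<circ> x \<circ> s) i, x (Suc i mod n)) \<in> r"
      using arcs by auto
  qed
qed

text \<open>Only the arcs leaving \<open>p\<close> and \<open>u\<close> are scarce, so it is enough
  to fix the successors of these two: \<open>y1\<close> after \<open>p\<close>, and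
  \<open>x0\<close> after \<open>u\<close>.\<close>

lemma alternating_cycle_insert_two:
  assumes fin: "finite W" "finite Z" and card: "card W = k" "card Z = k" and k: "k \<ge> 2"
    and disj: "insert p W \<inter> insert u Z = {}" and new: "p \<notin> W" "u \<notin> Z"
    and mem: "x0 \<in> W" "y1 \<in> Z" and arcs: "(u, x0) \<in> r" "(p, y1) \<in> r"
    and out_W: "\<And>w z. w \<in> W \<Longrightarrow> z \<in> insert u Z \<Longrightarrow> (w, z) \<in> r"
    and out_Z: "\<And>w z. w \<in> insert p W \<Longrightarrow> z \<in> Z \<Longrightarrow> (z, w) \<in> r"
  shows "alternating_cycle r (Suc k)"
proof -
  \<comment> \<open>The order is \<open>x0, y 0, p, y1, ..., x k, u\<close> and back to
    \<open>x0\<close>; \<open>k\<close> \<ge> 2 keeps the positions \<open>1\<close> of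
    \<open>y1\<close> and \<open>k\<close> of \<open>u\<close> apart.\<close>
  obtain x where x: "bij_betw x {..<Suc k} (insert p W)" "x 0 = x0" "x 1 = p"
    using exists_bij_betw_two_values[of "insert p W" "Suc k" 0 1 x0 p] fin card k new mem by auto
  obtain y where y: "bij_betw y {..<Suc k} (insert u Z)" "y k = u" "y 1 = y1"
    using exists_bij_betw_two_values[of "insert u Z" "Suc k" k 1 u y1] fin card k new mem by auto
  have x_W: "x i \<in> W" if "i < Suc k" "i \<noteq> 1" for i
  proof -
    have "x i \<noteq> x 1" using x(1) that k by (auto simp: bij_betw_def dest!: inj_onD)
    moreover have "x i \<in> insert p W" using x(1) that by (auto simp: bij_betw_def)
    ultimately show ?thesis using x(3) by auto
  qed
  have y_Z: "y i \<in> Z" if "i < k" for i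
  proof -
    have "y i \<noteq> y k" using y(1) that by (auto simp: bij_betw_def dest!: inj_onD)
    moreover have "y i \<in> insert u Z" using y(1) that by (auto simp: bij_betw_def)
    ultimately show ?thesis using y(2) by auto
  qed
  show ?thesis
  proof (rule alternating_cycleI[OF x(1) y(1) disj])
    fix i assume i: "i < Suc k"
    show "(x i, y i) \<in> r"
    proof (cases "i = 1")
      case True then show ?thesis using x y arcs by simp
    next
      case False
      moreover have "y i \<in> insert u Z" using y(1) i by (auto simp: bij_betw_def)
      ultimately show ?thesis using x_W i out_W by blast
    qed
    show "(y i, x (Suc i mod Suc k)) \<in> r"
    proof (cases "i = k")
      case True then show ?thesis using x y arcs by simp
    next
      case False
      then have "x (Suc i) \<in> insert p W" using x(1) i by (auto simp: bij_betw_def)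
      then show ?thesis using False i y_Z[of i] out_Z by simp
    qed
  qed
qed

section \<open>Big vertices in a bipartite relation\<close>

text \<open>The assumptions are symmetric in \<open>X\<close> and \<open>Y\<close>, so each fact
  about one side transfers to the other through \<open>swapped\<close>. As \<open>big\<close> is a
  parameter, both instances speak of the same predicate.\<close>

locale dominating_bipartite =
  fixes r :: "'a rel" and X Y :: "'a set" and a :: nat and big :: "'a \<Rightarrow> bool"
  assumes finite: "finite X" "finite Y"
    and disjoint: "X \<inter> Y = {}"
    and bipartite: "r \<subseteq> X \<times> Y \<union> Y \<times> X"
    and card: "card X = a" "card Y = a"
    and a_ge: "a \<ge> 4"
    and big_iff: "big v \<longleftrightarrow> 2 * a - 1 \<le> card (r `` {v}) + card (r\<inverse> `` {v})"
    and dominating: "\<lbrakk>x \<noteq> y; (x, z) \<in> r; (y, z) \<in> r\<rbrakk> \<Longrightarrow> big x \<or> big y"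
begin

lemma swapped: "dominating_bipartite r Y X a big"
  using finite disjoint bipartite card a_ge big_iff dominating
  by unfold_locales auto

lemma big_misses_at_most_one:
  assumes "x \<in> X" "big x"
  shows "card (Y - r `` {x}) + card (Y - r\<inverse> `` {x}) \<le> 1"
proof -
  have sub: "r `` {x} \<subseteq> Y" "r\<inverse> `` {x} \<subseteq> Y"
    using assms(1) bipartite disjoint by blast+
  have "card (Y - r `` {x}) = a - card (r `` {x})"
      "card (Y - r\<inverse> `` {x}) = a - card (r\<inverse> `` {x})"
    using card_Diff_subset[OF finite_subset[OF sub(1) finite(2)] sub(1)]
      card_Diff_subset[OF finite_subset[OF sub(2) finite(2)] sub(2)] card(2) by simp_all
  \<comment> \<open>These bounds rule out truncation in the two differences.\<close>
  moreover have "card (r `` {x}) \<le> a" "card (r\<inverse> `` {x}) \<le> a"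
    using card_mono[OF finite(2) sub(1)] card_mono[OF finite(2) sub(2)] card(2) by simp_all
  ultimately show ?thesis
    using assms(2) a_ge big_iff[of x] by linarith
qed

text \<open>Arcs of opposite direction are different even at the same neighbour, so
  \<open>y = y'\<close> is allowed here, unlike in the next two lemmas.\<close>

lemma big_out_or_in:
  assumes "x \<in> X" "big x" "y \<in> Y" "y' \<in> Y"
  shows "(x, y) \<in> r \<or> (y', x) \<in> r"
proof (rule ccontr)
  assume "\<not> ?thesis"
  then have "Y - r `` {x} \<noteq> {}" "Y - r\<inverse> `` {x} \<noteq> {}"
    using assms by auto
  then have "card (Y - r `` {x}) > 0" "card (Y - r\<inverse> `` {x}) > 0"
    using finite by (auto simp: card_gt_0_iff)
  then show False using big_misses_at_most_one[OF assms(1,2)] by linarith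
qed

lemma big_out_or_out:
  assumes "x \<in> X" "big x" "y \<in> Y" "y' \<in> Y" "y \<noteq> y'"
  shows "(x, y) \<in> r \<or> (x, y') \<in> r"
proof (rule ccontr)
  assume "\<not> ?thesis"
  then have "card {y, y'} \<le> card (Y - r `` {x})"
    using assms finite by (intro card_mono) auto
  then show False using big_misses_at_most_one[OF assms(1,2)] assms(5) by simp
qed

lemma big_in_or_in:
  assumes "x \<in> X" "big x" "y \<in> Y" "y' \<in> Y" "y \<noteq> y'"
  shows "(y, x) \<in> r \<or> (y', x) \<in> r"
proof (rule ccontr)
  assume "\<not> ?thesis"
  then have "card {y, y'} \<le> card (Y - r\<inverse> `` {x})"
    using assms finite by (intro card_mono) auto
  then show False using big_misses_at_most_one[OF assms(1,2)] assms(5) by simp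
qed

text \<open>Two vertices that are not big cannot both dominate \<open>x\<close>. Of three such
  vertices at least two would send no arc to \<open>x\<close>, which misses at most one arc.\<close>

lemma card_not_big_le:
  assumes "x \<in> X" "big x"
  shows "card {y \<in> Y. \<not> big y} \<le> 2"
proof (rule ccontr)
  assume "\<not> ?thesis"
  then have "3 \<le> card {y \<in> Y. \<not> big y}" by simp
  then obtain S where "S \<subseteq> {y \<in> Y. \<not> big y}" "card S = 3"
    by (meson obtain_subset_with_card_n)
  then obtain u v w where uvw: "u \<in> Y" "v \<in> Y" "w \<in> Y" "\<not> big u" "\<not> big v" "\<not> big w"
    "u \<noteq> v" "u \<noteq> w" "v \<noteq> w"
    by (auto simp: card_3_iff)
  then have "(u, x) \<notin> r \<or> (v, x) \<notin> r" "(u, x) \<notin> r \<or> (w, x) \<notin> r" "(v, x) \<notin> r \<or> (w, x) \<notin> r"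
    using dominating by blast+
  then show False
    using big_in_or_in[OF assms uvw(1,2,7)] big_in_or_in[OF assms uvw(1,3,8)]
      big_in_or_in[OF assms uvw(2,3,9)] by argo
qed

lemma card_big: "card {y \<in> Y. big y} = a - card {y \<in> Y. \<not> big y}"
proof -
  have "{y \<in> Y. big y} = Y - {y \<in> Y. \<not> big y}" by auto
  then show ?thesis using finite card by (simp add: card_Diff_subset)
qed

lemma card_big_ge:
  assumes "x \<in> X" "big x"
  shows "card {y \<in> Y. big y} \<ge> a - 2"
  using card_not_big_le[OF assms] card_big by simp

text \<open>The single arc that \<open>x\<close> may miss is already one from \<open>u\<close> or
  \<open>v\<close>, and a big \<open>y\<close> is neither of these.\<close>

lemma big_complete:
  assumes "x \<in> X" "big x" "u \<in> Y" "v \<in> Y" "u \<noteq> v" "\<not> big u" "\<not> big v" "y \<in> Y"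
  shows "(x, y) \<in> r" and "big y \<Longrightarrow> (y, x) \<in> r"
proof -
  have miss: "(u, x) \<notin> r \<or> (v, x) \<notin> r"
    using dominating assms by blast
  then show "(x, y) \<in> r"
    using big_out_or_in[OF assms(1,2) assms(8)] assms by blast
  show "(y, x) \<in> r" if "big y"
    using miss big_in_or_in[OF assms(1,2) assms(8)] assms that by blast
qed

section \<open>Cycles according to the number of vertices that are not big\<close>

lemma two_not_big:
  assumes "card {y \<in> Y. \<not> big y} = 2" and x0: "x0 \<in> X" "big x0"
  shows "alternating_cycle r (a - 1)"
proof -
  interpret sw: dominating_bipartite r Y X a big by (rule swapped)
  obtain u v where uv: "{y \<in> Y. \<not> big y} = {u, v}" "u \<noteq> v"
    using assms(1) by (auto simp: card_2_iff)
  then have uv': "u \<in> Y" "v \<in> Y" "\<not> big u" "\<not> big v" by auto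
  note complete = big_complete[OF _ _ uv'(1,2) uv(2) uv'(3,4)]
  \<comment> \<open>The extra vertex on the \<open>Y\<close> side: one of \<open>u\<close> and
    \<open>v\<close> sends an arc to \<open>x0\<close>, since \<open>x0\<close> cannot miss
    both.\<close>
  obtain q where q: "q \<in> Y" "\<not> big q" "(q, x0) \<in> r"
    using big_in_or_in[OF x0 uv'(1,2) uv(2)] uv' by blast
  define Z where "Z = {y \<in> Y. big y}"
  have Z: "card Z = a - 2" "finite Z"
    unfolding Z_def using card_big assms(1) finite by auto
  then have "Z \<noteq> {}"
    using a_ge by auto
  then obtain y1 where y1: "y1 \<in> Z" by blast
  then have y1': "y1 \<in> Y" "big y1" by (auto simp: Z_def)
  \<comment> \<open>\<open>p\<close> is the extra vertex on the \<open>X\<close> side. The cases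
    differ in whether \<open>X\<close> has a big vertex to spare for it.\<close>
  have "\<exists>p W. W \<subseteq> {x \<in> X. big x} \<and> x0 \<in> W \<and> card W = a - 2 \<and> p \<in> X \<and> p \<notin> W \<and>
      (p, y1) \<in> r \<and> (\<forall>z\<in>Z. (z, p) \<in> r)"
  proof (cases "card {x \<in> X. \<not> big x} = 2")
    case True
    then obtain p' q' where pq: "{x \<in> X. \<not> big x} = {p', q'}" "p' \<noteq> q'"
      by (auto simp: card_2_iff)
    then have pq': "p' \<in> X" "q' \<in> X" "\<not> big p'" "\<not> big q'" by auto
    \<comment> \<open>All \<open>a - 2\<close> big vertices of \<open>X\<close> go into
      \<open>W\<close>, so \<open>p\<close> is not big; it is chosen as \<open>q\<close> was, with
      the sides exchanged.\<close>
    obtain p where p: "p \<in> X" "\<not> big p" "(p, y1) \<in> r"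
      using sw.big_in_or_in[OF y1' pq'(1,2) pq(2)] pq' by blast
    have "(z, p) \<in> r" if "z \<in> Z" for z
      using sw.big_complete(1)[OF _ _ pq'(1,2) pq(2) pq'(3,4) p(1)] that by (auto simp: Z_def)
    then show ?thesis
      using p x0 sw.card_big True by (intro exI[of _ p] exI[of _ "{x \<in> X. big x}"]) auto
  next
    case False
    then have "card {x \<in> X. big x} \<ge> a - 1"
      using sw.card_not_big_le[OF y1'] sw.card_big by simp
    then have "card ({x \<in> X. big x} - {x0}) \<ge> a - 2"
      using x0 finite by simp
    \<comment> \<open>\<open>V\<close> avoids \<open>x0\<close>; exchanging some \<open>p\<close> in
      \<open>V\<close> for \<open>x0\<close> gives \<open>W\<close>, and \<open>p\<close> itself is
      big.\<close>
    then obtain V where V: "V \<subseteq> {x \<in> X. big x} - {x0}" "card V = a - 2"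
      by (meson obtain_subset_with_card_n)
    then have "V \<noteq> {}"
      using a_ge by auto
    then obtain p where p: "p \<in> V" by blast
    let ?W = "insert x0 (V - {p})"
    have "V \<subseteq> X" using V by auto
    then have "finite V" using finite finite_subset by blast
    then have "card ?W = a - 2"
      using V p a_ge by (subst card_insert_disjoint) auto
    moreover have "(p, y1) \<in> r" "\<forall>z\<in>Z. (z, p) \<in> r"
      using complete[of p] p V y1' by (auto simp: Z_def)
    ultimately show ?thesis
      using x0 V p by (intro exI[of _ p] exI[of _ ?W]) auto
  qed
  then obtain p W where W: "W \<subseteq> {x \<in> X. big x}" "x0 \<in> W" "card W = a - 2"
    and p: "p \<in> X" "p \<notin> W" "(p, y1) \<in> r" "\<forall>z\<in>Z. (z, p) \<in> r"
    by blast
  have "W \<subseteq> X" using W by auto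
  then have "finite W" using finite finite_subset by blast
  then have "alternating_cycle r (Suc (a - 2))"
  proof (rule alternating_cycle_insert_two[of W Z _ p q x0 y1])
    show "insert p W \<inter> insert q Z = {}"
      using disjoint W p q by (auto simp: Z_def)
    show "(w, z) \<in> r" if "w \<in> W" "z \<in> insert q Z" for w z
      using that complete(1) W q by (auto simp: Z_def)
    show "(z, w) \<in> r" if "w \<in> insert p W" "z \<in> Z" for w z
      using that complete(2) W p by (auto simp: Z_def)
  qed (use Z W p q y1 a_ge in \<open>auto simp: Z_def\<close>)
  moreover have "Suc (a - 2) = a - 1" using a_ge by linarith
  ultimately show ?thesis by (simp only:)
qed

lemma at_most_one_not_big:
  assumes "card {x \<in> X. \<not> big x} \<le> 1" "card {y \<in> Y. \<not> big y} \<le> 1"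
  shows "alternating_cycle r (a - 1)"
proof -
  interpret sw: dominating_bipartite r Y X a big by (rule swapped)
  have "a - 1 \<le> card {x \<in> X. big x}" "a - 1 \<le> card {y \<in> Y. big y}"
    unfolding card_big sw.card_big using assms by linarith+
  then obtain A B where A: "A \<subseteq> {x \<in> X. big x}" "card A = a - 1"
    and B: "B \<subseteq> {y \<in> Y. big y}" "card B = a - 1"
    by (elim obtain_subset_with_card_n)
  show ?thesis
  proof (rule alternating_cycle_minus_matching)
    show "finite A" "finite B"
      using finite_subset[OF A(1)] finite_subset[OF B(1)] finite by simp_all
    show "(x, y) \<in> r \<and> (y, x) \<in> r \<or> (x, y') \<in> r \<and> (y', x) \<in> r"
      if "x \<in> A" "y \<in> B" "y' \<in> B" "y \<noteq> y'" for x y y'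
    proof -
      have "x \<in> X" "big x" "y \<in> Y" "y' \<in> Y" using that A B by auto
      \<comment> \<open>Otherwise \<open>x\<close> misses an arc with \<open>y\<close> and another
        with \<open>y'\<close>; the four facts exclude the four combinations of directions.\<close>
      then show ?thesis
        using big_out_or_in[of x y y'] big_out_or_in[of x y' y] big_out_or_out[of x y y']
          big_in_or_in[of x y y'] that(4) by blast
    qed
    show "(x, y) \<in> r \<and> (y, x) \<in> r \<or> (x', y) \<in> r \<and> (y, x') \<in> r"
      if "x \<in> A" "x' \<in> A" "y \<in> B" "x \<noteq> x'" for x x' y
    proof -
      have "x \<in> X" "x' \<in> X" "y \<in> Y" "big y" using that A B by auto
      then show ?thesis
        using sw.big_out_or_in[of y x x'] sw.big_out_or_in[of y x' x] sw.big_out_or_out[of y x x']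
          sw.big_in_or_in[of y x x'] that(4) by blast
    qed
    show "A \<inter> B = {}"
      using A(1) B(1) disjoint by blast
    \<comment> \<open>\<open>a\<close> \<ge> 4 leaves the three vertices per side required for
      avoiding a matching.\<close>
    show "card A = a - 1" "card B = a - 1" "3 \<le> a - 1"
      using A(2) B(2) a_ge by simp_all
  qed
qed

lemma alternating_cycle_if_big:
  assumes "x \<in> X" "big x"
  shows "alternating_cycle r (a - 1)"
proof -
  interpret sw: dominating_bipartite r Y X a big by (rule swapped)
  \<comment> \<open>A big vertex on the other side makes the bound of two vertices that are not big
    available for both sides.\<close>
  have "card {y \<in> Y. big y} > 0"
    using card_big_ge[OF assms] a_ge by linarith
  then have "{y \<in> Y. big y} \<noteq> {}"
    unfolding card_gt_0_iff by (rule conjunct1)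
  then obtain y where y: "y \<in> Y" "big y" by blast
  consider "card {y \<in> Y. \<not> big y} = 2" | "card {x \<in> X. \<not> big x} = 2"
    | "card {x \<in> X. \<not> big x} \<le> 1" "card {y \<in> Y. \<not> big y} \<le> 1"
    using card_not_big_le[OF assms] sw.card_not_big_le[OF y] by linarith
  \<comment> \<open>The conclusion does not mention the partite sets, so the swapped instance yields
    the same statement.\<close>
  then show ?thesis
    using two_not_big[OF _ assms] sw.two_not_big[OF _ y] at_most_one_not_big by cases
qed

end

section \<open>From alternating cycles to cycles of a digraph\<close>

context wf_digraph
begin

lemma cycle_of_vertex_sequence:
  assumes "n > 0" "inj_on w {..<n}" "\<And>i. i < n \<Longrightarrow> w i \<rightarrow>\<^bsub>G\<^esub> w (Suc i mod n)"
  shows "\<exists>p. cycle p \<and> length p = n"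
proof -
  have "\<forall>i. \<exists>e. i < n \<longrightarrow> e \<in> arcs G \<and> tail G e = w i \<and> head G e = w (Suc i mod n)"
    using assms(3) by (metis reachableE)
  then obtain e where e: "\<And>i. i < n \<Longrightarrow> e i \<in> arcs G" "\<And>i. i < n \<Longrightarrow> tail G (e i) = w i"
    "\<And>i. i < n \<Longrightarrow> head G (e i) = w (Suc i mod n)"
    by metis
  \<comment> \<open>Induction on \<open>n - i\<close> peels arcs off the front; the last arc, at
    \<open>Suc i = n\<close>, wraps around to \<open>w 0\<close>.\<close>
  have cas: "cas (w i) (map e [i..<n]) (w 0)" if "i < n" for i
    using that
  proof (induction "n - i" arbitrary: i)
    case (Suc k)
    show ?case
    proof (cases "Suc i = n")
      case True
      then show ?thesis using e[of i] Suc.prems by (simp add: upt_conv_Cons)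
    next
      case False
      then have "Suc i < n" using Suc.prems by simp
      with Suc.hyps(1)[of "Suc i"] Suc.hyps(2) show ?thesis
        using e[of i] Suc.prems by (simp add: upt_conv_Cons)
    qed
  qed simp
  let ?p = "map e [0..<n]"
  have verts: "awalk_verts (w 0) ?p = map w [0..<n] @ [w 0]"
    using assms(1) e by (simp add: awalk_verts_conv last_map)
  \<comment> \<open>\<open>w 0\<close> occurs at both ends of the vertex list, so
    \<open>cycle\<close> asks for distinctness only of the tail of that list.\<close>
  have "distinct (tl (map w [0..<n] @ [w 0]))"
    using assms(1) inj_on_subset[OF assms(2), of "{Suc 0..<n}"]
    by (auto simp: subset_eq upt_conv_Cons distinct_map inj_on_eq_iff[OF assms(2)])
  moreover have "awalk (w 0) ?p (w 0)"
    unfolding awalk_def using cas[of 0] e assms(1) tail_in_verts[of "e 0"] by auto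
  ultimately have "cycle ?p"
    unfolding cycle_def using verts assms(1) by (metis length_greater_0_conv length_map length_upt diff_zero)
  then show ?thesis by (intro exI[of _ ?p]) simp
qed

lemma cycle_of_alternating_cycle:
  assumes "alternating_cycle (arcs_ends G) n" "n > 0"
  shows "\<exists>p. cycle p \<and> length p = 2 * n"
proof -
  obtain x y where xy: "inj_on x {..<n}" "inj_on y {..<n}" "x ` {..<n} \<inter> y ` {..<n} = {}"
    and arcs: "\<And>i. i < n \<Longrightarrow> x i \<rightarrow>\<^bsub>G\<^esub> y i" "\<And>i. i < n \<Longrightarrow> y i \<rightarrow>\<^bsub>G\<^esub> x (Suc i mod n)"
    using assms(1) unfolding alternating_cycle_def by auto
  define w where "w i = (if even i then x (i div 2) else y (i div 2))" for i
  have "inj_on w {..<2 * n}"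
  proof (rule inj_onI)
    fix i j assume ij: "i \<in> {..<2 * n}" "j \<in> {..<2 * n}" "w i = w j"
    then have lt: "i div 2 < n" "j div 2 < n" by auto
    \<comment> \<open>The ranges of \<open>x\<close> and \<open>y\<close> are disjoint, so a vertex
      determines the parity of its position.\<close>
    then have "even i = even j"
      using ij xy(3) by (auto simp: w_def split: if_splits)
    moreover from this have "i div 2 = j div 2"
      using ij lt xy(1,2) by (auto simp: w_def split: if_splits dest: inj_onD)
    ultimately show "i = j" by (metis even_two_times_div_two odd_two_times_div_two_succ)
  qed
  moreover have "w i \<rightarrow>\<^bsub>G\<^esub> w (Suc i mod (2 * n))" if "i < 2 * n" for i
  proof (cases "even i")
    case True
    \<comment> \<open>The last position \<open>2 * n - 1\<close> is odd, so an even position never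
      wraps around.\<close>
    then have "Suc i < 2 * n" using that by (metis Suc_lessI even_Suc even_mult_iff even_numeral)
    then show ?thesis using True arcs(1)[of "i div 2"] by (simp add: w_def)
  next
    case False
    then obtain k where k: "i = 2 * k + 1" by (elim oddE)
    then have "Suc i mod (2 * n) = 2 * (Suc k mod n)"
      by (simp add: mult_mod_right)
    then show ?thesis using k that arcs(2)[of k] by (simp add: w_def)
  qed
  ultimately show ?thesis
    using assms(2) by (intro cycle_of_vertex_sequence) auto
qed

end

section \<open>Degrees, and digraphs without dominating pairs\<close>

lemma (in digraph) degree_conv:
  "vertex_degree G v = card (arcs_ends G `` {v}) + card ((arcs_ends G)\<inverse> `` {v})"
proof -
  have "arcs_ends G `` {v} = head G ` out_arcs G v" "(arcs_ends G)\<inverse> `` {v} = tail G ` in_arcs G v"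
    by (force simp: arcs_ends_conv)+
  \<comment> \<open>Without parallel arcs, the out-arcs and in-arcs at \<open>v\<close> correspond
    to its out-neighbours and in-neighbours.\<close>
  moreover have "inj_on (head G) (out_arcs G v)" "inj_on (tail G) (in_arcs G v)"
    by (auto intro!: inj_onI no_multi_arcs simp: arc_to_ends_def)
  ultimately show ?thesis
    by (simp add: vertex_degree_def out_degree_def in_degree_def card_image)
qed

\<comment> \<open>In-neighbours being unique, a cycle is closed under predecessors, so it contains every
  vertex that reaches it.\<close>
lemma (in digraph) is_directed_cycle_if_no_dominating_pair:
  assumes "strongly_connected G" "card (verts G) \<ge> 2"
    and no_pair: "\<And>x y. \<not> dominating_pair G x y"
  shows "is_directed_cycle G"
proof -
  have in_unique: "e = e'" if "e \<in> arcs G" "e' \<in> arcs G" "head G e = head G e'" for e e'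
  proof (rule ccontr)
    assume "e \<noteq> e'"
    then have "tail G e \<noteq> tail G e'"
      using that no_multi_arcs[of e e'] by (auto simp: arc_to_ends_def)
    moreover have "tail G e \<rightarrow>\<^bsub>G\<^esub> head G e" "tail G e' \<rightarrow>\<^bsub>G\<^esub> head G e"
      using that by (auto intro!: dominatesI simp: arc_to_ends_def)
    ultimately show False
      using no_pair[of "tail G e" "tail G e'"] that unfolding dominating_pair_def by auto
  qed
  \<comment> \<open>Going from one vertex to a different one and back gives a nonempty closed
    walk.\<close>
  obtain S where "S \<subseteq> verts G" "card S = 2"
    using obtain_subset_with_card_n[OF assms(2)] by blast
  then obtain u v where uv: "u \<in> verts G" "v \<in> verts G" "u \<noteq> v"
    by (auto simp: card_2_iff)
  then have "u \<rightarrow>\<^sup>* v" "v \<rightarrow>\<^sup>* u"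
    using assms(1) unfolding strongly_connected_def by blast+
  then obtain p1 p2 where p12: "awalk u p1 v" "awalk v p2 u"
    unfolding reachable_awalk by blast
  then have "awalk u (p1 @ p2) u"
    by (rule awalk_appendI)
  moreover have "p1 \<noteq> []"
    using p12(1) uv(3) by (auto simp: awalk_Nil_iff)
  ultimately have "closed_w (p1 @ p2)"
    unfolding closed_w_def by blast
  then obtain p where p: "cycle p" using closed_w_imp_cycle by blast
  then obtain w where w: "awalk w p w" "p \<noteq> []" unfolding cycle_def by blast
  then have set_p: "set p \<subseteq> arcs G" by auto
  have heads: "head G ` set p = tail G ` set p"
  proof -
    \<comment> \<open>The vertices of a closed walk at \<open>w\<close> can be listed as the tails
      followed by \<open>w\<close>, or as \<open>w\<close> followed by the heads.\<close>
    have shift: "map (tail G) p @ [w] = w # map (head G) p"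
    proof -
      have "cas w p w" "last (awalk_verts w p) = w" using w(1) by auto
      then show ?thesis
        using w(2) awalk_verts_conv[of w p] awalk_verts_conv'[of w p w] by (simp add: cas_simp)
    qed
    have "w \<in> tail G ` set p"
      using shift w(2) by (cases p) auto
    moreover have "w \<in> head G ` set p"
      using shift w(2) by (cases p rule: rev_cases) auto
    moreover have "insert w (tail G ` set p) = insert w (head G ` set p)"
      using arg_cong[OF shift, of set] by simp
    ultimately show ?thesis by (simp add: insert_absorb)
  qed
  have absorb: "e \<in> set p" if "e \<in> arcs G" "head G e \<in> tail G ` set p" for e
  proof -
    have "head G e \<in> head G ` set p"
      using that(2) heads by simp
    then obtain e' where "e' \<in> set p" "head G e = head G e'"
      by (rule imageE)
    then show ?thesis
      using in_unique[of e e'] that(1) set_p by blast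
  qed
  have hd_p: "hd p \<in> set p"
    using w(2) by simp
  have "x \<in> tail G ` set p" if "x \<in> verts G" for x
  proof -
    have "x \<rightarrow>\<^sup>* tail G (hd p)"
      using assms(1) that hd_p set_p tail_in_verts unfolding strongly_connected_def by blast
    then show ?thesis
    proof (induction rule: converse_reachable_induct)
      case base
      show ?case using hd_p by (rule imageI)
    next
      case (step x y)
      obtain e where "e \<in> arcs G" "tail G e = x" "head G e = y"
        using step.hyps(1) by (rule reachableE)
      then show ?case
        using absorb[of e] step.IH by blast
    qed
  qed
  then have verts: "verts G = tail G ` set p"
    using set_p tail_in_verts by blast
  \<comment> \<open>Every head is now the tail of an arc of \<open>p\<close>, so
    \<open>absorb\<close> applies to all arcs.\<close>
  moreover have "arcs G = set p"
    using absorb set_p verts head_in_verts by blast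
  ultimately show ?thesis
    using p unfolding is_directed_cycle_def by blast
qed

theorem theorem1p8:
  fixes D :: "('a, 'b) pre_digraph" and X Y :: "'a set" and a :: nat
  assumes "digraph D"
    and "strongly_connected D"
    and "balanced_bipartition D X Y"
    and "card (verts D) = 2 * a"
    and "2 * a \<ge> 8"
    and "\<And>x y. dominating_pair D x y \<Longrightarrow>
           max (vertex_degree D x) (vertex_degree D y) \<ge> 2 * a - 1"
  shows "(\<exists>p. pre_digraph.cycle D p \<and> length p = 2 * a - 2) \<or> is_directed_cycle D"
proof (cases "\<exists>x y. dominating_pair D x y")
  interpret digraph D by (rule assms(1))
  case False
  have "2 \<le> card (verts D)"
    using assms(4,5) by simp
  with assms(2) have "is_directed_cycle D"
    by (rule is_directed_cycle_if_no_dominating_pair) (use False in blast)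
  then show ?thesis ..
next
  interpret digraph D by (rule assms(1))
  case True
  then obtain x y where "dominating_pair D x y" by blast
  then have "x \<in> verts D" "y \<in> verts D"
    and "2 * a - 1 \<le> vertex_degree D x \<or> 2 * a - 1 \<le> vertex_degree D y"
    using assms(6)[of x y] unfolding dominating_pair_def le_max_iff_disj by simp_all
  then obtain b where b: "b \<in> verts D" "2 * a - 1 \<le> vertex_degree D b" by blast
  have XY: "X \<union> Y = verts D" "X \<inter> Y = {}" "card X = card Y"
    and arcs: "\<And>e. e \<in> arcs D \<Longrightarrow> tail D e \<in> X \<and> head D e \<in> Y \<or> tail D e \<in> Y \<and> head D e \<in> X"
    using assms(3) by (auto simp: balanced_bipartition_def bipartition_def)
  have fin: "finite X" "finite Y"
    using XY(1) finite_verts finite_Un[of X Y] by simp_all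
  then have cards: "card X = a" "card Y = a"
    using XY assms(4) card_Un_disjoint[OF fin XY(2)] by simp_all
  interpret dominating_bipartite "arcs_ends D" X Y a "\<lambda>v. 2 * a - 1 \<le> vertex_degree D v"
  proof
    show "arcs_ends D \<subseteq> X \<times> Y \<union> Y \<times> X"
      using arcs by (auto simp: arcs_ends_conv)
    show "2 * a - 1 \<le> vertex_degree D x \<or> 2 * a - 1 \<le> vertex_degree D y"
      if "x \<noteq> y" "x \<rightarrow>\<^bsub>D\<^esub> z" "y \<rightarrow>\<^bsub>D\<^esub> z" for x y z
    proof -
      have "dominating_pair D x y"
        using that adj_in_verts unfolding dominating_pair_def by blast
      then show ?thesis
        using assms(6) le_max_iff_disj by blast
    qed
    show "2 * a - 1 \<le> vertex_degree D v \<longleftrightarrow>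
        2 * a - 1 \<le> card (arcs_ends D `` {v}) + card ((arcs_ends D)\<inverse> `` {v})" for v
      by (simp only: degree_conv)
    show "4 \<le> a" using assms(5) by simp
  qed (fact fin XY(2) cards)+
  \<comment> \<open>The big vertex \<open>b\<close> lies in \<open>X\<close> or in \<open>Y\<close>;
    the latter case is the swapped instance.\<close>
  have "alternating_cycle (arcs_ends D) (a - 1)"
    using b XY(1) alternating_cycle_if_big
      dominating_bipartite.alternating_cycle_if_big[OF swapped] by blast
  then have "\<exists>p. cycle p \<and> length p = 2 * (a - 1)"
    using assms(5) by (intro cycle_of_alternating_cycle) auto
  then show ?thesis
    by (simp add: diff_mult_distrib2)
qed

end
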